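(* Let $\mathtt{P}=(\mathtt{P_{yes}},\mathtt{P_{no}})$ be a promise problem over a unary alphabet $\{a\}$. If $\mathtt{P}$ is solved exactly by a quantum finite automaton (i.e. every string in $\mathtt{P_{yes}}$ is accepted with probability $1$ and every string in $\mathtt{P_{no}}$ is accepted with probability $0$), then $\mathtt{P}$ is also solved by a deterministic finite automaton (DFA), i.e. there is a DFA accepting every string in $\mathtt{P_{yes}}$ and rejecting every string in $\mathtt{P_{no}}$.
   Context: A promise problem over $\Sigma$ is a pair of disjoint languages $\mathtt{P_{yes}},\mathtt{P_{no}}\subseteq\Sigma^*$; behaviour on strings outside $\mathtt{P_{yes}}\cup\mathtt{P_{no}}$ is irrelevant. The paper's QFA model is the Moore–Crutchfield QFA: a tuple $(Q,\Sigma,\{U_\sigma\}_{\sigma\in\Sigma},|v_0\rangle,Q_a)$ with finite state set $Q$, unitary $|Q|\times|Q|$ matrices $U_\sigma$, a unit-norm complex initial vector $|v_0\rangle$, and accepting set $Q_a\subseteq Q$; on input $w=w_1\cdots w_\ell$ the state is $|v_j\rangle=U_{w_j}|v_{j-1}\rangle$ and the acceptance probability is $\sum_{q_j\in Q_a}|\,|v_\ell\rangle(j)|^2$. *)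

theory Defs
  imports "HOL-Analysis.Analysis"
begin

definition promise_problem :: "'a set \<Rightarrow> 'a list set \<Rightarrow> 'a list set \<Rightarrow> bool" where
  "promise_problem \<Sigma> Pyes Pno \<longleftrightarrow>
     Pyes \<subseteq> lists \<Sigma> \<and> Pno \<subseteq> lists \<Sigma> \<and> Pyes \<inter> Pno = {}"

definition conj_transpose :: "complex ^ 'n ^ 'm \<Rightarrow> complex ^ 'm ^ 'n" where
  "conj_transpose A = (\<chi> i j. cnj (A $ j $ i))"

definition unitary :: "complex ^ 'n ^ 'n \<Rightarrow> bool" where
  "unitary U \<longleftrightarrow> conj_transpose U ** U = mat 1 \<and> U ** conj_transpose U = mat 1"

text \<open>
  The state set of a Moore--Crutchfield automaton is the whole finite type \<open>'q\<close>, which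
  also indexes the vectors and matrices.
\<close>

record ('q, 'a) qfa =
  qfa_matrix :: "'a \<Rightarrow> complex ^ ('q::finite) ^ 'q"
  qfa_init :: "complex ^ 'q"
  qfa_accepting :: "'q set"

definition is_qfa :: "'a set \<Rightarrow> ('q::finite, 'a) qfa \<Rightarrow> bool" where
  "is_qfa \<Sigma> A \<longleftrightarrow> (\<forall>\<sigma>\<in>\<Sigma>. unitary (qfa_matrix A \<sigma>)) \<and> norm (qfa_init A) = 1"

definition qfa_final :: "('q::finite, 'a) qfa \<Rightarrow> 'a list \<Rightarrow> complex ^ 'q" where
  "qfa_final A w = fold (\<lambda>\<sigma> v. qfa_matrix A \<sigma> *v v) w (qfa_init A)"

definition qfa_accept_prob :: "('q::finite, 'a) qfa \<Rightarrow> 'a list \<Rightarrow> real" where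
  "qfa_accept_prob A w = (\<Sum>q\<in>qfa_accepting A. (cmod (qfa_final A w $ q))\<^sup>2)"

definition qfa_solves_exactly ::
  "('q::finite, 'a) qfa \<Rightarrow> 'a list set \<Rightarrow> 'a list set \<Rightarrow> bool" where
  "qfa_solves_exactly A Pyes Pno \<longleftrightarrow>
     (\<forall>w\<in>Pyes. qfa_accept_prob A w = 1) \<and> (\<forall>w\<in>Pno. qfa_accept_prob A w = 0)"

text \<open>
  DFAs carry an explicit finite state set, so that their existence can be asserted over the
  state type \<open>nat\<close>: up to renaming of states, every DFA has this form.
\<close>

record ('q, 'a) dfa =
  dfa_states :: "'q set"
  dfa_next :: "'q \<Rightarrow> 'a \<Rightarrow> 'q"
  dfa_init :: 'q
  dfa_accepting :: "'q set"

definition is_dfa :: "'a set \<Rightarrow> ('q, 'a) dfa \<Rightarrow> bool" where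
  "is_dfa \<Sigma> D \<longleftrightarrow>
     finite (dfa_states D) \<and>
     dfa_init D \<in> dfa_states D \<and>
     dfa_accepting D \<subseteq> dfa_states D \<and>
     (\<forall>q\<in>dfa_states D. \<forall>\<sigma>\<in>\<Sigma>. dfa_next D q \<sigma> \<in> dfa_states D)"

definition dfa_accepts :: "('q, 'a) dfa \<Rightarrow> 'a list \<Rightarrow> bool" where
  "dfa_accepts D w \<longleftrightarrow> foldl (dfa_next D) (dfa_init D) w \<in> dfa_accepting D"

definition dfa_solves :: "('q, 'a) dfa \<Rightarrow> 'a list set \<Rightarrow> 'a list set \<Rightarrow> bool" where
  "dfa_solves D Pyes Pno \<longleftrightarrow>
     (\<forall>w\<in>Pyes. dfa_accepts D w) \<and> (\<forall>w\<in>Pno. \<not> dfa_accepts D w)"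

end

theory Submission
  imports Defs "HOL-Computational_Algebra.Fundamental_Theorem_Algebra"
begin

text \<open>
  Acceptance probability \<open>0\<close> means that finitely many coordinates of \<open>U\<^sup>n v\<close> vanish.  These are linear
  recurrence sequences, so by the Skolem--Mahler--Lech theorem their zero sets are eventually periodic,
  and a DFA can decide whether the probability is \<open>0\<close>.

  Skolem--Mahler--Lech over \<open>\<complex>\<close> is reduced to \<open>\<int>\<close>.  The roots of the characteristic polynomial are
  algebraic over \<open>R = \<int>[t\<^sub>1, \<dots>, t\<^sub>k]\<close> with \<open>t\<^sub>1, \<dots>, t\<^sub>k\<close> algebraically independent, so the sequence
  satisfies a recurrence over \<open>R\<close>; an \<open>R\<close>-linear functional and a specialization \<open>t \<mapsto> a \<in> \<int>\<^sup>k\<close> turn it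
  into an integer recurrence in which a given nonzero term stays nonzero.  An integer solution with
  outer coefficients prime to \<open>p\<close> is periodic modulo \<open>p\<^sup>2\<close> with a period \<open>N\<close> that depends only on \<open>p\<close> and
  the order; hence along a residue class modulo \<open>N\<close> it has the form \<open>\<Sum>i. (x choose i) p\<^sup>2\<^sup>i b\<^sub>i\<close>, and
  Hansel's elementary argument shows that such a function with infinitely many zeros vanishes.
\<close>

section \<open>Integer recurrences\<close>

lemma fact_add_coprime:
  fixes p k r :: nat
  assumes "prime p" "r < p"
  shows "\<exists>q. coprime q p \<and> fact (p * k + r) = q * (fact (p * k) :: nat)"
  using assms(2)
proof (induction r)
  case 0
  show ?case by (intro exI[of _ 1]) auto
next
  case (Suc r)
  then obtain q where q: "coprime q p" "fact (p * k + r) = q * (fact (p * k) :: nat)"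
    by auto
  have "\<not> p dvd Suc (p * k + r)"
    using Suc.prems by (metis add_Suc_right dvd_add_right_iff dvd_triv_left nat_dvd_not_less zero_less_Suc)
  then have "coprime (Suc (p * k + r)) p"
    using assms(1) by (simp add: coprime_commute prime_imp_coprime)
  then have "coprime (Suc (p * k + r) * q) p"
    using q(1) by (simp only: coprime_mult_left_iff)
  moreover have "fact (p * k + Suc r) = (Suc (p * k + r) * q) * (fact (p * k) :: nat)"
    using q(2) by (simp add: algebra_simps)
  ultimately show ?case by blast
qed

text \<open>Of the factors of \<open>fact (p * k)\<close>, the \<open>k\<close> multiples of
  \<open>p\<close> contribute \<open>p ^ k * fact k\<close>; all others are prime to
  \<open>p\<close>.\<close>

lemma fact_mult_coprime:
  fixes p k :: nat
  assumes "prime p"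
  shows "\<exists>q. coprime q p \<and> fact (p * k) = q * p ^ k * (fact k :: nat)"
proof (induction k)
  case 0
  show ?case by (intro exI[of _ 1]) auto
next
  case (Suc k)
  then obtain q where q: "coprime q p" "fact (p * k) = q * p ^ k * (fact k :: nat)"
    by auto
  have p0: "p > 0" using assms prime_gt_0_nat by blast
  obtain q' where q': "coprime q' p" "fact (p * k + (p - 1)) = q' * (fact (p * k) :: nat)"
    using fact_add_coprime[OF assms, of "p - 1" k] p0 by auto
  have "p * Suc k = Suc (p * k + (p - 1))" using p0 by simp
  then have "(fact (p * Suc k) :: nat) = (p * Suc k) * fact (p * k + (p - 1))"
    by (metis fact_Suc of_nat_id)
  also have "\<dots> = (q' * q) * p ^ Suc k * fact (Suc k)"
    using q'(2) q(2) by (simp add: algebra_simps)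
  finally show ?case using q(1) q'(1) by (metis coprime_mult_left_iff)
qed

text \<open>The \<open>p\<close>-adic valuation of \<open>i!\<close> is at most \<open>i\<close>:
  with \<open>k = i div p\<close> it is \<open>k\<close> plus the valuation of \<open>k!\<close>,
  which is at most \<open>k\<close> by induction, and \<open>2 * k \<le> i\<close>.\<close>

lemma fact_dvd_coprime_mult_power:
  fixes p i :: nat
  assumes "prime p"
  shows "\<exists>q. coprime q p \<and> fact i dvd q * p ^ i"
proof (induction i rule: less_induct)
  case (less i)
  show ?case
  proof (cases "i = 0")
    case True
    then show ?thesis by (intro exI[of _ 1]) auto
  next
    case False
    define k r where "k = i div p" and "r = i mod p"
    have p2: "p \<ge> 2" using assms prime_ge_2_nat by blast
    have i: "i = p * k + r" "r < p" using p2 by (auto simp: k_def r_def)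
    have "k < i" using False p2 by (simp add: k_def)
    then obtain q where q: "coprime q p" "fact k dvd q * p ^ k" using less by blast
    obtain q1 where q1: "coprime q1 p" "fact (p * k) = q1 * p ^ k * (fact k :: nat)"
      using fact_mult_coprime[OF assms] by blast
    obtain q2 where q2: "coprime q2 p" "fact i = q2 * (fact (p * k) :: nat)"
      using fact_add_coprime[OF assms i(2)] i(1) by blast
    have "2 * k \<le> p * k" using p2 by (rule mult_right_mono) simp
    then have ki: "k + k \<le> i" using i(1) by linarith
    have "fact i = (q2 * q1 * p ^ k) * (fact k :: nat)" using q2 q1 by (simp add: mult_ac)
    also have "\<dots> dvd (q2 * q1 * p ^ k) * (q * p ^ k)" using q(2) by (rule mult_dvd_mono[OF dvd_refl])
    also have "\<dots> = (q2 * q1 * q) * p ^ (k + k)" by (simp add: power_add mult_ac)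
    also have "\<dots> dvd (q2 * q1 * q) * p ^ i"
      using ki by (intro mult_dvd_mono dvd_refl le_imp_power_dvd)
    finally show ?thesis using q(1) q1(1) q2(1) by (intro exI[of _ "q2 * q1 * q"]) auto
  qed
qed

lemma fact_dvd_uniform:
  fixes p n :: nat
  assumes "prime p"
  shows "\<exists>q. coprime q p \<and> (\<forall>i\<le>n. fact i dvd q * p ^ i)"
proof (induction n)
  case 0
  show ?case by (intro exI[of _ 1]) auto
next
  case (Suc n)
  then obtain q where q: "coprime q p" "\<forall>i\<le>n. fact i dvd q * p ^ i" by blast
  obtain q' where q': "coprime q' p" "fact (Suc n) dvd q' * p ^ Suc n"
    using fact_dvd_coprime_mult_power[OF assms] by blast
  have "fact i dvd (q * q') * p ^ i" if "i \<le> Suc n" for i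
  proof (cases "i = Suc n")
    case True
    then show ?thesis using dvd_mult[OF q'(2), of q] by (simp only: mult.assoc)
  next
    case False
    then have "fact i dvd q * p ^ i" using that q(2) by simp
    then show ?thesis using dvd_mult[of "fact i" "q * p ^ i" q'] by (simp only: mult_ac)
  qed
  then show ?case using q(1) q'(1) by (intro exI[of _ "q * q'"]) auto
qed

section \<open>Integer polynomials with many roots\<close>

text \<open>Splitting off a linear factor for each root lowers by one the index from which
  \<open>c\<close> divides all coefficients; after \<open>card T\<close> divisions it divides every
  coefficient of the quotient.\<close>

lemma dvd_poly_if_dvd_high_coeffs:
  fixes A :: "int poly"
  assumes "finite T" "\<forall>t\<in>T. poly A t = 0" "\<forall>k\<ge>card T. c dvd coeff A k"
  shows "c dvd poly A x"
  using assms
proof (induction T arbitrary: A rule: finite_induct)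
  case empty
  then show ?case by (auto simp: poly_altdef intro!: dvd_sum)
next
  case (insert t T)
  define B where "B = synthetic_div A t"
  have A: "A = [:-t, 1:] * B"
    using synthetic_div_correct'[of t A] insert.prems(1) by (simp add: B_def)
  \<comment> \<open>Descending from above the degree, this relation passes divisibility by
    \<open>c\<close> from \<open>coeff B (Suc k)\<close> to \<open>coeff B k\<close>.\<close>
  have cA: "coeff A (Suc k) = coeff B k - t * coeff B (Suc k)" for k
    unfolding A by simp
  have "\<forall>k\<ge>card T. c dvd coeff B k"
  proof (intro allI impI)
    fix k assume k: "card T \<le> k"
    have "k \<le> max k (Suc (degree B))" by simp
    then show "c dvd coeff B k"
      using k
    proof (induction k rule: inc_induct)
      case base
      then show ?case by (cases "k \<le> degree B") (auto simp: max_def coeff_eq_0)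
    next
      case (step j)
      have "c dvd coeff A (Suc j)" using insert step.prems by simp
      then have "c dvd coeff A (Suc j) + t * coeff B (Suc j)" using step by simp
      then show ?case by (simp add: cA)
    qed
  qed
  moreover have "\<forall>s\<in>T. poly B s = 0"
    using insert.prems(1) insert.hyps(2) unfolding A by auto
  ultimately have "c dvd poly B x" using insert.IH by blast
  then show ?case unfolding A by simp
qed

text \<open>The binomial coefficient \<open>X choose i\<close> with its denominator
  \<open>i!\<close> cleared.\<close>

definition falling_poly :: "nat \<Rightarrow> int poly" where
  "falling_poly i = (\<Prod>j<i. [:- int j, 1:])"

lemma degree_falling_poly: "degree (falling_poly i) = i"
  unfolding falling_poly_def by (subst degree_prod_eq_sum_degree) auto

lemma poly_falling_poly: "poly (falling_poly i) (int x) = fact i * int (x choose i)"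
proof -
  have "real_of_int (poly (falling_poly i) (int x)) = (\<Prod>j = 0..<i. real x - real j)"
    by (simp add: falling_poly_def poly_prod lessThan_atLeast0)
  also have "\<dots> = fact i * (real x gchoose i)"
    by (simp add: gbinomial_mult_fact)
  also have "\<dots> = real_of_int (fact i * int (x choose i))"
    by (simp add: binomial_gbinomial)
  finally show ?thesis by linarith
qed

text \<open>
  Since \<open>i!\<close> divides \<open>q p\<^sup>i\<close> with \<open>q\<close> prime to \<open>p\<close>, a truncation of the series times \<open>q\<close> is an integer
  polynomial whose coefficients of index at least \<open>K\<close> are divisible by \<open>p\<^sup>K\<close>.  Dividing out \<open>K\<close> zeros
  shows \<open>p\<^sup>K dvd d x\<close>, for every \<open>K\<close>.
\<close>

lemma infinitely_many_zeros_imp_zero: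
  fixes p :: nat and d b :: "nat \<Rightarrow> int"
  assumes p: "prime p"
    and d: "\<And>x. d x = (\<Sum>i\<le>x. int (x choose i) * (int p ^ (2 * i) * b i))"
    and inf: "infinite {x. d x = 0}"
  shows "d x = 0"
proof (rule ccontr)
  assume nz: "d x \<noteq> 0"
  have "int p ^ K dvd d x" for K
  proof -
    obtain T where T: "finite T" "card T = K" "T \<subseteq> {x. d x = 0}"
      using infinite_arbitrarily_large[OF inf] by blast
    \<comment> \<open>For \<open>t \<le> n\<close> the terms with index beyond \<open>t\<close>
      vanish, so the series can be cut off at \<open>n\<close> for all relevant points at
      once.\<close>
    define n where "n = Max (insert x T)"
    have n: "t \<le> n" if "t \<in> insert x T" for t using that T(1) by (simp add: n_def)
    obtain q where q: "coprime q p" "\<And>i. i \<le> n \<Longrightarrow> fact i dvd q * p ^ i"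
      using fact_dvd_uniform[OF p] by blast
    define g where "g i = int (q * p ^ i div fact i)" for i
    have g: "g i * fact i = int q * int p ^ i" if "i \<le> n" for i
    proof -
      have "q * p ^ i div fact i * fact i = q * p ^ i" using q(2)[OF that] by simp
      then have "int (q * p ^ i div fact i * fact i) = int (q * p ^ i)" by simp
      then show ?thesis by (simp add: g_def)
    qed
    \<comment> \<open>One factor \<open>p ^ i\<close> of \<open>p ^ (2 * i)\<close> absorbs the
      denominator \<open>i!\<close> up to \<open>q\<close>; the other stays in the coefficient and
      makes the high coefficients divisible.\<close>
    define A where "A = (\<Sum>i\<le>n. smult (g i * int p ^ i * b i) (falling_poly i))"
    have polyA: "poly A (int t) = int q * d t" if "t \<in> insert x T" for t
    proof -
      have "poly A (int t) = (\<Sum>i\<le>n. (g i * fact i) * int p ^ i * b i * int (t choose i))"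
        by (simp add: A_def poly_sum poly_falling_poly mult_ac)
      also have "\<dots> = (\<Sum>i\<le>n. int q * (int (t choose i) * (int p ^ (2 * i) * b i)))"
      proof (intro sum.cong refl)
        fix i assume "i \<in> {..n}"
        then have "g i * fact i = int q * int p ^ i" using g by simp
        then show "(g i * fact i) * int p ^ i * b i * int (t choose i) =
            int q * (int (t choose i) * (int p ^ (2 * i) * b i))"
          by (simp add: power_even_eq power2_eq_square)
      qed
      also have "\<dots> = (\<Sum>i\<le>t. int q * (int (t choose i) * (int p ^ (2 * i) * b i)))"
        using n[OF that] by (intro sum.mono_neutral_right) auto
      also have "\<dots> = int q * d t" by (simp add: d sum_distrib_left)
      finally show ?thesis .
    qed
    have "int p ^ K dvd coeff A k" if "k \<ge> K" for k
    proof -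
      have "int p ^ K dvd coeff (smult (g i * int p ^ i * b i) (falling_poly i)) k" for i
      proof (cases "i < k")
        case True
        then show ?thesis by (simp add: coeff_eq_0 degree_falling_poly)
      next
        case False
        then have "int p ^ K dvd int p ^ i" using that by (simp add: le_imp_power_dvd)
        then show ?thesis by simp
      qed
      then show ?thesis unfolding A_def coeff_sum by (intro dvd_sum) auto
    qed
    moreover have "card (int ` T) = K" using T(2) by (simp add: card_image)
    moreover have "\<forall>t\<in>int ` T. poly A t = 0" using polyA T(3) by auto
    ultimately have "int p ^ K dvd poly A (int x)"
      using dvd_poly_if_dvd_high_coeffs[of "int ` T" A] T(1) by auto
    then have "int p ^ K dvd int q * d x" using polyA by simp
    moreover have "coprime (int p ^ K) (int q)"
      using q(1) by (simp add: coprime_commute)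
    ultimately show ?thesis by (simp add: coprime_dvd_mult_right_iff)
  qed
  \<comment> \<open>A nonzero \<open>d x\<close> divisible by \<open>p ^ K\<close> has absolute
    value at least \<open>p ^ K\<close>, which fails for \<open>K = nat |d x|\<close>.\<close>
  from dvd_imp_le_int[OF nz this[of "nat \<bar>d x\<bar>"]] have "int p ^ nat \<bar>d x\<bar> \<le> \<bar>d x\<bar>"
    by simp
  moreover have "nat \<bar>d x\<bar> < p ^ nat \<bar>d x\<bar>"
    using p prime_gt_1_nat power_gt_expt by auto
  then have "int (nat \<bar>d x\<bar>) < int p ^ nat \<bar>d x\<bar>" by (metis of_nat_less_iff of_nat_power)
  ultimately show False by simp
qed

section \<open>Linear recurrences modulo an integer\<close>

text \<open>
  Solutions of a linear recurrence \<open>\<Sum>i\<le>m. g i * z (n + i) = 0\<close> whose outer coefficients are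
  units modulo \<open>c\<close>: modulo \<open>c\<close>, the window of \<open>m\<close> consecutive values determines both the next and
  the previous value, so the sequence is purely periodic by the pigeonhole principle.
\<close>

definition solves_rec :: "(nat \<Rightarrow> 'b::comm_ring_1) \<Rightarrow> nat \<Rightarrow> (nat \<Rightarrow> 'b) \<Rightarrow> bool" where
  "solves_rec g m z \<longleftrightarrow> (\<forall>n. (\<Sum>i\<le>m. g i * z (n + i)) = 0)"

lemma rec_determines_next:
  fixes g z :: "nat \<Rightarrow> int"
  assumes z: "solves_rec g m z" and g: "coprime (g m) c"
    and eq: "\<And>l. l < m \<Longrightarrow> c dvd z (i + l) - z (j + l)"
  shows "c dvd z (i + l) - z (j + l)"
proof (induction l rule: less_induct)
  case (less l)
  show ?case
  proof (cases "l < m")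
    case True
    then show ?thesis using eq by simp
  next
    case False
    then obtain e where e: "l = e + m" by (metis add.commute le_add_diff_inverse not_less)
    have s: "(\<Sum>k\<le>m. g k * z (i + e + k)) = 0" "(\<Sum>k\<le>m. g k * z (j + e + k)) = 0"
      using z unfolding solves_rec_def by auto
    have "(\<Sum>k\<le>m. g k * (z (i + (e + k)) - z (j + (e + k)))) = 0"
      using s by (simp add: sum_subtractf right_diff_distrib add.assoc)
    then have "g m * (z (i + l) - z (j + l)) = - (\<Sum>k<m. g k * (z (i + (e + k)) - z (j + (e + k))))"
      unfolding lessThan_Suc_atMost[symmetric] e by simp
    moreover have "c dvd (\<Sum>k<m. g k * (z (i + (e + k)) - z (j + (e + k))))"
      by (intro dvd_sum dvd_mult less) (simp add: e)
    ultimately have "c dvd g m * (z (i + l) - z (j + l))" by simp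
    then show ?thesis using g by (simp add: coprime_dvd_mult_right_iff coprime_commute)
  qed
qed

lemma rec_determines_previous:
  fixes g z :: "nat \<Rightarrow> int"
  assumes z: "solves_rec g m z" and g: "coprime (g 0) c"
    and eq: "\<And>l. c dvd z (i + l) - z (i + D + l)"
  shows "c dvd z n - z (n + D)"
proof (cases "n \<le> i")
  case False
  then show ?thesis using eq[of "n - i"] by (simp add: add.commute add.left_commute)
next
  case True
  \<comment> \<open>The backward induction carries the whole tail, since the recurrence at
    \<open>n\<close> involves the \<open>m\<close> following values.\<close>
  have "\<forall>l. c dvd z (n + l) - z (n + D + l)"
    using True
  proof (induction n rule: inc_induct)
    case base
    then show ?case using eq by blast
  next
    case (step n)
    have s: "(\<Sum>k\<le>m. g k * z (n + k)) = 0" "(\<Sum>k\<le>m. g k * z (n + D + k)) = 0"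
      using z unfolding solves_rec_def by auto
    have "(\<Sum>k\<le>m. g k * (z (n + k) - z (n + D + k))) = 0"
      using s by (simp add: sum_subtractf right_diff_distrib)
    moreover have "(\<Sum>k\<le>m. g k * (z (n + k) - z (n + D + k))) = g 0 * (z n - z (n + D)) +
        (\<Sum>k<m. g (Suc k) * (z (Suc n + k) - z (Suc n + D + k)))"
      unfolding lessThan_Suc_atMost[symmetric] by (subst sum.lessThan_Suc_shift) simp
    moreover have "c dvd (\<Sum>k<m. g (Suc k) * (z (Suc n + k) - z (Suc n + D + k)))"
      by (intro dvd_sum dvd_mult) (use step.IH in blast)
    ultimately have "c dvd g 0 * (z n - z (n + D))"
      by (simp add: add_eq_0_iff2)
    then have 0: "c dvd z n - z (n + D)"
      using g by (simp add: coprime_dvd_mult_right_iff coprime_commute)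
    show ?case
    proof
      fix l show "c dvd z (n + l) - z (n + D + l)"
        using 0 step.IH by (cases l) auto
    qed
  qed
  then show ?thesis by (auto dest: spec[of _ 0])
qed

text \<open>Pigeonhole on the \<open>c ^ m\<close> possible windows gives a period
  \<open>D \<le> c ^ m\<close> that may vary with the sequence; the factorial is a common multiple
  of all candidates and depends only on \<open>c\<close> and \<open>m\<close>.\<close>

lemma rec_periodic_mod:
  fixes g z :: "nat \<Rightarrow> int" and c :: nat
  assumes z: "solves_rec g m z" and g: "coprime (g 0) (int c)" "coprime (g m) (int c)" and c: "c > 0"
  shows "int c dvd z (n + fact (c ^ m)) - z n"
proof -
  define st where "st i = map (\<lambda>l. z (i + l) mod int c) [0..<m]" for i
  define L where "L = {xs. set xs \<subseteq> {0..<int c} \<and> length xs = m}"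
  have L: "finite L" "card L = c ^ m"
    unfolding L_def by (auto simp: finite_lists_length_eq card_lists_length_eq)
  have "st ` {..c ^ m} \<subseteq> L" using c by (auto simp: st_def L_def)
  then have "card (st ` {..c ^ m}) \<le> c ^ m" using L by (metis card_mono)
  then have "\<not> inj_on st {..c ^ m}" using card_image[of st "{..c ^ m}"] by auto
  then obtain i j where ij: "i < j" "j \<le> c ^ m" "st i = st j"
    unfolding inj_on_def by (metis atMost_iff linorder_neqE_nat)
  define D where "D = j - i"
  have D: "0 < D" "D \<le> c ^ m" "j = i + D" using ij by (auto simp: D_def)
  have "int c dvd z (i + l) - z (j + l)" if "l < m" for l
  proof -
    have "st i ! l = st j ! l" using ij by simp
    then show ?thesis using that by (simp add: st_def mod_eq_dvd_iff)
  qed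
  then have "int c dvd z (i + l) - z (i + D + l)" for l
    using rec_determines_next[OF z g(2)] D(3) by blast
  then have per: "int c dvd z n - z (n + D)" for n
    using rec_determines_previous[OF z g(1)] by blast
  have "int c dvd z (n + D * k) - z n" for k
  proof (induction k)
    case 0
    then show ?case by simp
  next
    case (Suc k)
    have "z (n + D * Suc k) - z n = (z (n + D * k) - z n) - (z (n + D * k) - z (n + D * k + D))"
      by (simp add: algebra_simps)
    then show ?case using Suc per[of "n + D * k"] by (metis dvd_diff)
  qed
  moreover have "(D::nat) dvd fact (c ^ m)" using D by (intro dvd_fact) auto
  then obtain k where "fact (c ^ m) = D * k" by (elim dvdE)
  ultimately show ?thesis by simp
qed

text \<open>
  Newton's forward difference formula with step \<open>N\<close>; all iterated differences are divisible by the
  corresponding power of \<open>c\<close>, because \<open>(z (n + N) - z n) / c\<close> solves the same recurrence.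
\<close>

lemma rec_newton_expansion:
  fixes g z :: "nat \<Rightarrow> int" and c :: nat
  assumes z: "solves_rec g m z" and g: "coprime (g 0) (int c)" "coprime (g m) (int c)" and c: "c > 0"
  shows "\<exists>b. \<forall>x. z (r + fact (c ^ m) * x) = (\<Sum>i\<le>x. int (x choose i) * (int c ^ i * b i))"
proof -
  define N :: nat where "N = fact (c ^ m)"
  define \<delta> where "\<delta> y n = (y (n + N) - y n) div int c" for y :: "nat \<Rightarrow> int" and n
  have \<delta>: "int c * \<delta> y n = y (n + N) - y n" if "solves_rec g m y" for y n
    unfolding \<delta>_def N_def using rec_periodic_mod[OF that g c] by simp
  have \<delta>_rec: "solves_rec g m (\<delta> y)" if y: "solves_rec g m y" for y
    unfolding solves_rec_def
  proof
    fix n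
    have "int c * (\<Sum>i\<le>m. g i * \<delta> y (n + i)) = (\<Sum>i\<le>m. g i * (int c * \<delta> y (n + i)))"
      by (simp add: sum_distrib_left mult_ac)
    also have "\<dots> = (\<Sum>i\<le>m. g i * y (n + N + i)) - (\<Sum>i\<le>m. g i * y (n + i))"
      by (simp add: \<delta>[OF y] right_diff_distrib sum_subtractf add_ac)
    also have "\<dots> = 0" using y by (simp add: solves_rec_def)
    finally show "(\<Sum>i\<le>m. g i * \<delta> y (n + i)) = 0" using c by simp
  qed
  have "y (r + N * x) = (\<Sum>i\<le>x. int (x choose i) * (int c ^ i * (\<delta> ^^ i) y r))"
    if "solves_rec g m y" for x y
    using that
  proof (induction x arbitrary: y)
    case 0
    then show ?case by simp
  next
    case (Suc x)
    have pow: "(\<delta> ^^ i) (\<delta> y) = (\<delta> ^^ Suc i) y" for i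
      by (simp add: funpow_swap1)
    \<comment> \<open>The induction hypothesis is applied to both \<open>y\<close> and
      \<open>\<delta> y\<close>; Pascal's rule merges the two expansions.\<close>
    have "y (r + N * Suc x) = y (r + N * x) + int c * \<delta> y (r + N * x)"
      using \<delta>[OF Suc.prems] by (simp add: algebra_simps)
    also have "\<dots> = (\<Sum>i\<le>x. int (x choose i) * (int c ^ i * (\<delta> ^^ i) y r)) +
        (\<Sum>i\<le>x. int (x choose i) * (int c ^ Suc i * (\<delta> ^^ Suc i) y r))"
      unfolding Suc.IH[OF Suc.prems] Suc.IH[OF \<delta>_rec[OF Suc.prems]] pow
      by (simp add: sum_distrib_left mult_ac)
    also have "(\<Sum>i\<le>x. int (x choose i) * (int c ^ i * (\<delta> ^^ i) y r)) =
        (\<Sum>i\<le>Suc x. int (x choose i) * (int c ^ i * (\<delta> ^^ i) y r))"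
      by simp
    also have "\<dots> = y r + (\<Sum>i\<le>x. int (x choose Suc i) * (int c ^ Suc i * (\<delta> ^^ Suc i) y r))"
      by (subst sum.atMost_Suc_shift) simp
    also have "\<dots> + (\<Sum>i\<le>x. int (x choose i) * (int c ^ Suc i * (\<delta> ^^ Suc i) y r)) =
        y r + (\<Sum>i\<le>x. int (Suc x choose Suc i) * (int c ^ Suc i * (\<delta> ^^ Suc i) y r))"
      by (simp only: sum.distrib binomial_Suc_Suc of_nat_add distrib_right add_ac)
    also have "\<dots> = (\<Sum>i\<le>Suc x. int (Suc x choose i) * (int c ^ i * (\<delta> ^^ i) y r))"
      by (subst sum.atMost_Suc_shift) simp
    finally show ?case .
  qed
  from this[OF z] show ?thesis unfolding N_def
    by (intro exI[of _ "\<lambda>i. (\<delta> ^^ i) z r"]) simp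
qed

text \<open>The modulus \<open>p\<^sup>2\<close> gives the Newton coefficients the factor
  \<open>p ^ (2 * i)\<close> on which the argument about infinitely many zeros relies.\<close>

lemma integer_rec_zeros:
  fixes g z :: "nat \<Rightarrow> int" and p :: nat
  assumes z: "solves_rec g m z" and p: "prime p" "\<not> int p dvd g 0" "\<not> int p dvd g m"
    and inf: "infinite {x. z (r + fact ((p\<^sup>2) ^ m) * x) = 0}"
  shows "z (r + fact ((p\<^sup>2) ^ m) * x) = 0"
proof -
  have cop: "coprime y (int (p\<^sup>2))" if "\<not> int p dvd y" for y
  proof -
    have "coprime (int p) y" using that p(1) by (intro prime_imp_coprime) auto
    then have "coprime y (int p)" by (rule coprime_commute[THEN iffD1])
    then show ?thesis by (simp only: of_nat_power coprime_power_right_iff simp_thms)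
  qed
  have "p\<^sup>2 > 0" using p(1) prime_gt_0_nat by simp
  from rec_newton_expansion[OF z cop[OF p(2)] cop[OF p(3)] this]
  obtain b where b: "\<And>x. z (r + fact ((p\<^sup>2) ^ m) * x) = (\<Sum>i\<le>x. int (x choose i) * (int (p\<^sup>2) ^ i * b i))"
    by blast
  then have "z (r + fact ((p\<^sup>2) ^ m) * x) = (\<Sum>i\<le>x. int (x choose i) * (int p ^ (2 * i) * b i))" for x
    by (simp only: of_nat_power power_mult)
  then show ?thesis
    by (rule infinitely_many_zeros_imp_zero[OF p(1) _ inf])
qed


section \<open>Specialization of finitely generated subrings of the complex numbers\<close>

definition subring :: "complex set \<Rightarrow> bool" where
  "subring R \<longleftrightarrow> 1 \<in> R \<and> (\<forall>x\<in>R. \<forall>y\<in>R. x - y \<in> R \<and> x * y \<in> R)"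

lemma subring_1: "subring R \<Longrightarrow> 1 \<in> R"
  and subring_diff: "subring R \<Longrightarrow> x \<in> R \<Longrightarrow> y \<in> R \<Longrightarrow> x - y \<in> R"
  and subring_mult: "subring R \<Longrightarrow> x \<in> R \<Longrightarrow> y \<in> R \<Longrightarrow> x * y \<in> R"
  by (auto simp: subring_def)

lemma subring_0: "subring R \<Longrightarrow> 0 \<in> R"
  using subring_diff[of R 1 1] subring_1 by simp

lemma subring_uminus: "subring R \<Longrightarrow> x \<in> R \<Longrightarrow> - x \<in> R"
  using subring_diff[of R 0 x] subring_0 by simp

lemma subring_add: "subring R \<Longrightarrow> x \<in> R \<Longrightarrow> y \<in> R \<Longrightarrow> x + y \<in> R"
  using subring_diff[of R x "- y"] subring_uminus by simp

lemma subring_power: "subring R \<Longrightarrow> x \<in> R \<Longrightarrow> x ^ n \<in> R"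
  by (induction n) (auto intro: subring_1 subring_mult)

lemma subring_of_nat: "subring R \<Longrightarrow> of_nat n \<in> R"
  by (induction n) (auto intro: subring_1 subring_0 subring_add)

lemma subring_sum: "subring R \<Longrightarrow> (\<And>i. i \<in> I \<Longrightarrow> f i \<in> R) \<Longrightarrow> sum f I \<in> R"
  by (induction I rule: infinite_finite_induct) (auto intro: subring_0 subring_add)

lemmas subring_closed = subring_0 subring_1 subring_diff subring_mult subring_uminus subring_add
  subring_power subring_of_nat subring_sum

definition hom_on :: "complex set \<Rightarrow> (complex \<Rightarrow> int) \<Rightarrow> bool" where
  "hom_on R \<phi> \<longleftrightarrow> \<phi> 1 = 1 \<and> (\<forall>x\<in>R. \<forall>y\<in>R. \<phi> (x + y) = \<phi> x + \<phi> y \<and> \<phi> (x * y) = \<phi> x * \<phi> y)"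

lemma hom_1: "hom_on R \<phi> \<Longrightarrow> \<phi> 1 = 1"
  and hom_add: "hom_on R \<phi> \<Longrightarrow> x \<in> R \<Longrightarrow> y \<in> R \<Longrightarrow> \<phi> (x + y) = \<phi> x + \<phi> y"
  and hom_mult: "hom_on R \<phi> \<Longrightarrow> x \<in> R \<Longrightarrow> y \<in> R \<Longrightarrow> \<phi> (x * y) = \<phi> x * \<phi> y"
  by (auto simp: hom_on_def)

lemma hom_0: "subring R \<Longrightarrow> hom_on R \<phi> \<Longrightarrow> \<phi> 0 = 0"
  using hom_add[of R \<phi> 0 0] subring_0[of R] by simp

lemma hom_power: "subring R \<Longrightarrow> hom_on R \<phi> \<Longrightarrow> x \<in> R \<Longrightarrow> \<phi> (x ^ n) = \<phi> x ^ n"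
  by (induction n) (auto simp: hom_1 hom_mult subring_power)

lemma hom_of_nat: "subring R \<Longrightarrow> hom_on R \<phi> \<Longrightarrow> \<phi> (of_nat n) = of_nat n"
  by (induction n) (auto simp: hom_0 hom_1 hom_add subring_1 subring_of_nat)

lemma hom_sum:
  "subring R \<Longrightarrow> hom_on R \<phi> \<Longrightarrow> (\<And>i. i \<in> I \<Longrightarrow> f i \<in> R) \<Longrightarrow> \<phi> (sum f I) = (\<Sum>i\<in>I. \<phi> (f i))"
  by (induction I rule: infinite_finite_induct) (auto simp: hom_0 hom_add subring_sum)

definition polys_over :: "complex set \<Rightarrow> complex poly set" where
  "polys_over R = {P. \<forall>i. coeff P i \<in> R}"

lemma polys_over_coeff: "P \<in> polys_over R \<Longrightarrow> coeff P i \<in> R"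
  by (simp add: polys_over_def)

lemma polys_over_const: "subring R \<Longrightarrow> r \<in> R \<Longrightarrow> [:r:] \<in> polys_over R"
  by (auto simp: polys_over_def coeff_pCons subring_0 split: nat.split)

lemma polys_over_linear: "subring R \<Longrightarrow> r \<in> R \<Longrightarrow> s \<in> R \<Longrightarrow> [:r, s:] \<in> polys_over R"
  by (auto simp: polys_over_def coeff_pCons subring_0 split: nat.split)

lemma polys_over_add: "subring R \<Longrightarrow> P \<in> polys_over R \<Longrightarrow> Q \<in> polys_over R \<Longrightarrow> P + Q \<in> polys_over R"
  by (auto simp: polys_over_def subring_add)

lemma polys_over_diff: "subring R \<Longrightarrow> P \<in> polys_over R \<Longrightarrow> Q \<in> polys_over R \<Longrightarrow> P - Q \<in> polys_over R"
  by (auto simp: polys_over_def subring_diff)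

lemma polys_over_mult: "subring R \<Longrightarrow> P \<in> polys_over R \<Longrightarrow> Q \<in> polys_over R \<Longrightarrow> P * Q \<in> polys_over R"
  by (auto simp: polys_over_def coeff_mult intro!: subring_sum subring_mult)

lemma polys_over_prod:
  "subring R \<Longrightarrow> (\<And>i. i \<in> I \<Longrightarrow> f i \<in> polys_over R) \<Longrightarrow> prod f I \<in> polys_over R"
  by (induction I rule: infinite_finite_induct)
    (auto intro: polys_over_mult polys_over_const[of R 1, simplified one_pCons[symmetric]] subring_1)

lemma hom_map_poly_add:
  assumes "subring R" "hom_on R \<phi>" "P \<in> polys_over R" "Q \<in> polys_over R"
  shows "map_poly \<phi> (P + Q) = map_poly \<phi> P + map_poly \<phi> Q"
  using assms by (intro poly_eqI) (simp add: coeff_map_poly hom_0 hom_add polys_over_coeff)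

lemma hom_map_poly_mult:
  assumes "subring R" "hom_on R \<phi>" "P \<in> polys_over R" "Q \<in> polys_over R"
  shows "map_poly \<phi> (P * Q) = map_poly \<phi> P * map_poly \<phi> Q"
  using assms
  by (intro poly_eqI)
    (simp add: coeff_map_poly coeff_mult hom_0 hom_mult hom_sum subring_mult polys_over_coeff)

section \<open>Specializable rings\<close>

text \<open>
  A subring of \<open>\<complex>\<close> that embeds into a product of copies of \<open>\<int>\<close>, even after restricting to the
  homomorphisms that keep a given nonzero element prime to some \<open>p\<close>.  The prime must not depend on the
  element \<open>r\<close> to be detected: it fixes the modulus of the periodicity.
\<close>

definition specializable :: "complex set \<Rightarrow> bool" where
  "specializable R \<longleftrightarrow> subring R \<and>
     (\<forall>s\<in>R - {0}. \<exists>p::nat. prime p \<and>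
        (\<forall>r\<in>R - {0}. \<exists>\<phi>. hom_on R \<phi> \<and> \<not> int p dvd \<phi> s \<and> \<phi> r \<noteq> 0))"

definition algebraic_over :: "complex set \<Rightarrow> complex \<Rightarrow> bool" where
  "algebraic_over R x \<longleftrightarrow> (\<exists>P\<in>polys_over R. P \<noteq> 0 \<and> poly P x = 0)"

text \<open>The identity of \<open>\<int>\<close> is the only homomorphism used, and a prime above
  the absolute value of \<open>s\<close> does not divide \<open>s\<close>.\<close>

lemma specializable_Ints: "specializable \<int>"
  unfolding specializable_def
proof (intro conjI ballI)
  show "subring \<int>" by (auto simp: subring_def)
  fix s :: complex assume "s \<in> \<int> - {0}"
  then obtain k where k: "s = of_int k" "k \<noteq> 0" by (auto elim: Ints_cases)
  obtain p :: nat where p: "prime p" "p > nat \<bar>k\<bar>" using bigger_prime by blast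
  show "\<exists>p::nat. prime p \<and> (\<forall>r\<in>\<int> - {0}. \<exists>\<phi>. hom_on \<int> \<phi> \<and> \<not> int p dvd \<phi> s \<and> \<phi> r \<noteq> 0)"
  proof (intro exI[of _ p] conjI ballI)
    show "prime p" by fact
    fix r :: complex assume r: "r \<in> \<int> - {0}"
    define \<phi> where "\<phi> z = \<lfloor>Re z\<rfloor>" for z
    have \<phi>: "\<phi> (of_int j) = j" for j by (simp add: \<phi>_def)
    have "hom_on \<int> \<phi>"
      unfolding hom_on_def
    proof (intro conjI ballI)
      show "\<phi> 1 = 1" using \<phi>[of 1] by simp
      fix x y :: complex assume "x \<in> \<int>" "y \<in> \<int>"
      then obtain i j where "x = of_int i" "y = of_int j" by (auto elim!: Ints_cases)
      then show "\<phi> (x + y) = \<phi> x + \<phi> y" "\<phi> (x * y) = \<phi> x * \<phi> y"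
        using \<phi>[of "i + j"] \<phi>[of "i * j"] by (simp_all add: \<phi>)
    qed
    moreover have "\<not> int p dvd \<phi> s"
      using k p by (auto simp: \<phi> dest: dvd_imp_le_int)
    moreover have "\<phi> r \<noteq> 0" using r by (auto simp: \<phi> elim: Ints_cases)
    ultimately show "\<exists>\<phi>. hom_on \<int> \<phi> \<and> \<not> int p dvd \<phi> s \<and> \<phi> r \<noteq> 0" by blast
  qed
qed

text \<open>The \<open>k + 1\<close> consecutive integers are distinct modulo \<open>p\<close>
  because \<open>k < p\<close>, and a nonzero polynomial of degree at most \<open>k\<close> over the
  field with \<open>p\<close> elements has at most \<open>k\<close> roots.\<close>

lemma dvd_coeff_if_dvd_values:
  fixes S :: "int poly" and p :: nat
  assumes "prime p" "k < p" "degree S \<le> k"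
    and "\<And>j. a \<le> j \<Longrightarrow> j \<le> a + int k \<Longrightarrow> int p dvd poly S j"
  shows "int p dvd coeff S k"
  using assms(2-)
proof (induction k arbitrary: a S)
  case 0
  then obtain c where "S = [:c:]" by (auto elim: degree_eq_zeroE)
  then show ?case using 0(3)[of a] by simp
next
  case (Suc k)
  define A where "A = synthetic_div S a"
  have S: "S = [:-a, 1:] * A + [:poly S a:]"
    unfolding A_def by (rule synthetic_div_correct'[symmetric])
  have deg: "degree A \<le> k" using Suc.prems(2) by (simp add: A_def degree_synthetic_div)
  have "int p dvd poly A j" if j: "a + 1 \<le> j" "j \<le> (a + 1) + int k" for j
  proof -
    have "poly S j = (j - a) * poly A j + poly S a" by (subst S) (simp add: algebra_simps)
    moreover have "int p dvd poly S j" "int p dvd poly S a" using Suc.prems(3) j by auto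
    ultimately have "int p dvd (j - a) * poly A j" by (metis add_diff_cancel_right' dvd_diff)
    moreover have "\<not> int p dvd (j - a)"
      using j Suc.prems(1) zdvd_not_zless[of "j - a" "int p"] by simp
    ultimately show ?thesis using assms(1) by (simp add: prime_dvd_mult_iff)
  qed
  then have "int p dvd coeff A k" using Suc.IH[of A "a + 1"] deg Suc.prems(1) by simp
  moreover have "coeff S (Suc k) = coeff A k"
    using deg by (subst S) (simp add: coeff_eq_0)
  ultimately show ?case by simp
qed

text \<open>Since \<open>x\<close> is transcendental, \<open>R[x]\<close> is a polynomial ring, and
  a homomorphism of \<open>R\<close> extends by sending \<open>x\<close> to any integer. That
  integer is chosen in a residue class modulo \<open>p\<close> that keeps the image of
  \<open>s\<close> prime to \<open>p\<close>, and away from the roots of the polynomial for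
  \<open>r\<close>.\<close>

lemma specializable_adjoin_transcendental:
  assumes R: "specializable R" and x: "\<not> algebraic_over R x"
  shows "specializable ((\<lambda>P. poly P x) ` polys_over R)" (is "specializable ?R'")
proof -
  have sub: "subring R" using R by (simp add: specializable_def)
  have inj: "P = Q" if "P \<in> polys_over R" "Q \<in> polys_over R" "poly P x = poly Q x" for P Q
  proof (rule ccontr)
    assume "P \<noteq> Q"
    then have "P - Q \<in> polys_over R" "P - Q \<noteq> 0" "poly (P - Q) x = 0"
      using that sub polys_over_diff by auto
    then show False using x unfolding algebraic_over_def by blast
  qed
  have ext: "\<exists>\<phi>'. hom_on ?R' \<phi>' \<and> (\<forall>P\<in>polys_over R. \<phi>' (poly P x) = poly (map_poly \<phi> P) a)"
    if \<phi>: "hom_on R \<phi>" for \<phi> a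
  proof -
    define Q where "Q y = (THE P. P \<in> polys_over R \<and> poly P x = y)" for y
    have Q: "Q (poly P x) = P" if "P \<in> polys_over R" for P
      unfolding Q_def using that inj by (intro the_equality) auto
    define \<phi>' where "\<phi>' y = poly (map_poly \<phi> (Q y)) a" for y
    have \<phi>': "\<phi>' (poly P x) = poly (map_poly \<phi> P) a" if "P \<in> polys_over R" for P
      using that by (simp add: \<phi>'_def Q)
    have "hom_on ?R' \<phi>'"
      unfolding hom_on_def
    proof (intro conjI ballI)
      have "1 \<in> polys_over R" using polys_over_const[OF sub subring_1[OF sub]] by (simp add: one_pCons)
      from \<phi>'[OF this] show "\<phi>' 1 = 1" using hom_1[OF \<phi>] by simp
      fix y z assume "y \<in> ?R'" "z \<in> ?R'"
      then obtain A B where AB: "y = poly A x" "z = poly B x" "A \<in> polys_over R" "B \<in> polys_over R"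
        by blast
      show "\<phi>' (y + z) = \<phi>' y + \<phi>' z"
        using \<phi>'[OF polys_over_add[OF sub AB(3,4)]] AB by (simp add: \<phi>' hom_map_poly_add[OF sub \<phi>])
      show "\<phi>' (y * z) = \<phi>' y * \<phi>' z"
        using \<phi>'[OF polys_over_mult[OF sub AB(3,4)]] AB by (simp add: \<phi>' hom_map_poly_mult[OF sub \<phi>])
    qed
    then show ?thesis using \<phi>' by blast
  qed
  show ?thesis
    unfolding specializable_def
  proof (intro conjI ballI)
    show "subring ?R'"
      unfolding subring_def
    proof (intro conjI ballI)
      show "1 \<in> ?R'"
        using polys_over_const[OF sub subring_1[OF sub]] by (intro image_eqI[of _ _ "[:1:]"]) auto
      fix y z assume "y \<in> ?R'" "z \<in> ?R'"
      then obtain A B where AB: "y = poly A x" "z = poly B x" "A \<in> polys_over R" "B \<in> polys_over R"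
        by blast
      show "y - z \<in> ?R'"
        using AB polys_over_diff[OF sub] by (intro image_eqI[of _ _ "A - B"]) auto
      show "y * z \<in> ?R'"
        using AB polys_over_mult[OF sub] by (intro image_eqI[of _ _ "A * B"]) auto
    qed
    have repr: "\<exists>P. P \<in> polys_over R \<and> y = poly P x \<and> P \<noteq> 0" if y: "y \<in> ?R' - {0}" for y
    proof -
      obtain P where "P \<in> polys_over R" "y = poly P x" using y by blast
      then show ?thesis using y by (intro exI[of _ P]) auto
    qed
    fix s assume "s \<in> ?R' - {0}"
    then obtain S where S: "S \<in> polys_over R" "s = poly S x" "S \<noteq> 0"
      using repr by blast
    define k where "k = degree S"
    have lc: "lead_coeff S \<in> R" "lead_coeff S \<noteq> 0" using S polys_over_coeff by auto
    \<comment> \<open>The leading coefficient keeps the image of \<open>S\<close> nonzero modulo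
      \<open>p\<close>, and the factor \<open>k!\<close> forces \<open>k < p\<close>, so that this
      image has a nonzero value modulo \<open>p\<close>. Neither depends on
      \<open>r\<close>.\<close>
    define s' where "s' = lead_coeff S * of_nat (fact k)"
    have "s' \<in> R - {0}"
      using lc sub by (auto simp: s'_def simp del: of_nat_fact intro!: subring_mult subring_of_nat)
    then obtain p where p: "prime p"
        "\<And>r. r \<in> R - {0} \<Longrightarrow> \<exists>\<phi>. hom_on R \<phi> \<and> \<not> int p dvd \<phi> s' \<and> \<phi> r \<noteq> 0"
      using R unfolding specializable_def by blast
    show "\<exists>p::nat. prime p \<and> (\<forall>r\<in>?R' - {0}. \<exists>\<phi>. hom_on ?R' \<phi> \<and> \<not> int p dvd \<phi> s \<and> \<phi> r \<noteq> 0)"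
    proof (intro exI[of _ p] conjI ballI)
      show "prime p" by fact
      fix r assume "r \<in> ?R' - {0}"
      then obtain Q where Q: "Q \<in> polys_over R" "r = poly Q x" "Q \<noteq> 0"
        using repr by blast
      then have "lead_coeff Q \<in> R - {0}" using polys_over_coeff by auto
      then obtain \<phi> where \<phi>: "hom_on R \<phi>" "\<not> int p dvd \<phi> s'" "\<phi> (lead_coeff Q) \<noteq> 0"
        using p(2) by blast
      have "\<phi> s' = \<phi> (lead_coeff S) * int (fact k)"
        unfolding s'_def using lc sub \<phi>(1) by (simp only: hom_mult subring_of_nat hom_of_nat)
      then have pS: "\<not> int p dvd \<phi> (lead_coeff S)" and "\<not> int p dvd int (fact k)"
        using \<phi>(2) by (auto simp del: of_nat_fact)
      then have "\<not> p dvd fact k" by (metis int_dvd_int_iff)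
      then have kp: "k < p" using p(1) by (simp add: prime_dvd_fact_iff)
      define S1 where "S1 = map_poly \<phi> S"
      have "coeff S1 k = \<phi> (lead_coeff S)" "degree S1 \<le> k"
        unfolding S1_def k_def using sub \<phi>(1) by (auto simp: coeff_map_poly hom_0 map_poly_degree_leq)
      then obtain a where a: "\<not> int p dvd poly S1 a"
        using dvd_coeff_if_dvd_values[OF p(1) kp, of S1 0] pS by auto
      define Q1 where "Q1 = map_poly \<phi> Q"
      have "coeff Q1 (degree Q) \<noteq> 0"
        unfolding Q1_def using sub \<phi> by (simp add: coeff_map_poly hom_0)
      then have "finite {b. poly Q1 b = 0}" by (intro poly_roots_finite) auto
      \<comment> \<open>Moving \<open>a\<close> by multiples of \<open>p\<close> keeps the value of
        \<open>S1\<close> modulo \<open>p\<close>, while only finitely many of these points are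
        roots of \<open>Q1\<close>.\<close>
      moreover have "infinite (range (\<lambda>j::nat. a + int p * int j))"
        using p(1) prime_gt_0_nat by (intro range_inj_infinite injI) auto
      ultimately have "\<not> range (\<lambda>j::nat. a + int p * int j) \<subseteq> {b. poly Q1 b = 0}"
        using finite_subset by blast
      then obtain j :: nat where j: "poly Q1 (a + int p * int j) \<noteq> 0" by auto
      define b where "b = a + int p * int j"
      obtain \<phi>' where \<phi>': "hom_on ?R' \<phi>'" "\<And>P. P \<in> polys_over R \<Longrightarrow> \<phi>' (poly P x) = poly (map_poly \<phi> P) b"
        using ext[OF \<phi>(1), of b] by blast
      have "b - a dvd poly S1 b - poly S1 a"
      proof -
        have "poly S1 b = (b - a) * poly (synthetic_div S1 a) b + poly S1 a"
          by (subst synthetic_div_correct'[of a S1, symmetric]) (simp add: algebra_simps)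
        then show ?thesis by simp
      qed
      then have "int p dvd poly S1 b - poly S1 a"
        unfolding b_def by (simp add: dvd_mult_left)
      then have "\<not> int p dvd poly S1 b" using a dvd_diff[of "int p" "poly S1 b" "poly S1 b - poly S1 a"] by auto
      then have "\<not> int p dvd \<phi>' s" using S \<phi>'(2) by (simp add: S1_def)
      moreover have "\<phi>' r \<noteq> 0" using Q \<phi>'(2) j by (simp add: Q1_def b_def)
      ultimately show "\<exists>\<phi>. hom_on ?R' \<phi> \<and> \<not> int p dvd \<phi> s \<and> \<phi> r \<noteq> 0" using \<phi>'(1) by blast
    qed
  qed
qed

lemma algebraic_over_mono: "R \<subseteq> R' \<Longrightarrow> algebraic_over R x \<Longrightarrow> algebraic_over R' x"
  unfolding algebraic_over_def polys_over_def by blast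

text \<open>Only elements transcendental over the ring built so far are adjoined; an adjoined
  element is algebraic as a member of the new ring.\<close>

lemma ex_specializable_algebraic:
  assumes "finite X"
  shows "\<exists>R. specializable R \<and> (\<forall>x\<in>X. algebraic_over R x)"
  using assms
proof (induction X rule: finite_induct)
  case empty
  then show ?case using specializable_Ints by auto
next
  case (insert x X)
  then obtain R where R: "specializable R" "\<forall>y\<in>X. algebraic_over R y" by blast
  show ?case
  proof (cases "algebraic_over R x")
    case True
    then show ?thesis using R by auto
  next
    case False
    define R' where "R' = (\<lambda>P. poly P x) ` polys_over R"
    have sub: "subring R" using R by (simp add: specializable_def)
    have R': "specializable R'" using specializable_adjoin_transcendental[OF R(1) False] by (simp add: R'_def)
    then have sub': "subring R'" by (simp add: specializable_def)
    have "R \<subseteq> R'"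
    proof
      fix r assume "r \<in> R"
      then have "[:r:] \<in> polys_over R" using sub by (rule polys_over_const[rotated])
      then show "r \<in> R'" unfolding R'_def by (intro image_eqI[of _ _ "[:r:]"]) auto
    qed
    then have "\<forall>y\<in>X. algebraic_over R' y" using R(2) algebraic_over_mono by blast
    moreover have "algebraic_over R' x"
    proof -
      have "[:0, 1:] \<in> polys_over R" using sub by (intro polys_over_linear subring_closed)
      then have "x \<in> R'" unfolding R'_def by (intro image_eqI[of _ _ "[:0, 1:]"]) auto
      then have "[:- x, 1:] \<in> polys_over R'" using sub' by (intro polys_over_linear subring_closed)
      then show ?thesis unfolding algebraic_over_def by (intro bexI[of _ "[:- x, 1:]"]) auto
    qed
    ultimately show ?thesis using R' by auto
  qed
qed

section \<open>Submodules of the complex numbers and linear functionals\<close>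

definition submodule :: "complex set \<Rightarrow> complex set \<Rightarrow> bool" where
  "submodule R M \<longleftrightarrow> (\<forall>x\<in>M. \<forall>y\<in>M. x + y \<in> M) \<and> (\<forall>r\<in>R. \<forall>x\<in>M. r * x \<in> M)"

definition functional_on :: "complex set \<Rightarrow> complex set \<Rightarrow> (complex \<Rightarrow> complex) \<Rightarrow> bool" where
  "functional_on R M \<psi> \<longleftrightarrow> \<psi> ` M \<subseteq> R \<and> (\<forall>x\<in>M. \<forall>y\<in>M. \<psi> (x + y) = \<psi> x + \<psi> y) \<and>
     (\<forall>r\<in>R. \<forall>x\<in>M. \<psi> (r * x) = r * \<psi> x)"

text \<open>
  In the induction a new generator \<open>w\<close> is either torsion modulo the old module \<open>M\<close>, with \<open>a * w \<in> M\<close>,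
  and then the functional is composed with multiplication by \<open>a\<close>, or the sum is direct and the
  functional is extended by \<open>0\<close>.
\<close>

lemma ex_functional:
  assumes R: "subring R" and W: "finite W" and w0: "w0 \<noteq> 0"
  shows "\<exists>M \<psi>. submodule R M \<and> insert w0 W \<subseteq> M \<and> functional_on R M \<psi> \<and> \<psi> w0 \<noteq> 0"
  using W
proof (induction W rule: finite_induct)
  case empty
  define M where "M = (\<lambda>r. r * w0) ` R"
  have "submodule R M"
    unfolding submodule_def M_def
    using R by (auto simp: distrib_right[symmetric] mult.assoc[symmetric] intro!: imageI subring_closed)
  \<comment> \<open>The module is free on \<open>w0\<close>, and division by \<open>w0\<close> is
    its coordinate function.\<close>
  moreover have "functional_on R M (\<lambda>z. z / w0)"
    using w0 by (auto simp: functional_on_def M_def add_divide_distrib)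
  moreover have "w0 \<in> M"
    unfolding M_def using R by (intro image_eqI[of _ _ 1]) (auto intro: subring_1)
  ultimately show ?case using w0 by (intro exI[of _ M] exI[of _ "\<lambda>z. z / w0"]) auto
next
  case (insert w W)
  then obtain M \<psi> where M: "submodule R M" "insert w0 W \<subseteq> M" "functional_on R M \<psi>" "\<psi> w0 \<noteq> 0"
    by blast
  have add: "x + y \<in> M" "\<psi> (x + y) = \<psi> x + \<psi> y" if "x \<in> M" "y \<in> M" for x y
    using M(1,3) that by (auto simp: submodule_def functional_on_def)
  have scale: "r * x \<in> M" "\<psi> (r * x) = r * \<psi> x" if "r \<in> R" "x \<in> M" for r x
    using M(1,3) that by (auto simp: submodule_def functional_on_def)
  have val: "\<psi> x \<in> R" if "x \<in> M" for x
    using M(3) that by (auto simp: functional_on_def)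
  have zero: "0 \<in> M" using scale(1)[of 0 w0] M(2) subring_0[OF R] by auto
  define M' where "M' = {m + r * w | m r. m \<in> M \<and> r \<in> R}"
  have M'I: "m + r * w \<in> M'" if "m \<in> M" "r \<in> R" for m r
    using that by (auto simp: M'_def)
  have sub: "submodule R M'"
    unfolding submodule_def
  proof (intro conjI ballI)
    fix x y assume "x \<in> M'" "y \<in> M'"
    then obtain m r m' r' where
      "x = m + r * w" "y = m' + r' * w" "m \<in> M" "m' \<in> M" "r \<in> R" "r' \<in> R"
      by (auto simp: M'_def)
    then show "x + y \<in> M'"
      using M'I[of "m + m'" "r + r'"] add R by (simp add: algebra_simps subring_add)
  next
    fix s x assume "s \<in> R" "x \<in> M'"
    then obtain m r where "x = m + r * w" "m \<in> M" "r \<in> R" by (auto simp: M'_def)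
    then show "s * x \<in> M'"
      using M'I[of "s * m" "s * r"] scale R \<open>s \<in> R\<close> by (simp add: distrib_left mult.assoc subring_mult)
  qed
  have "insert w0 (insert w W) \<subseteq> M'"
    using M(2) M'I[of _ 0] M'I[of 0 1] zero R by (auto simp: subring_0 subring_1)
  moreover have "\<exists>\<psi>'. functional_on R M' \<psi>' \<and> \<psi>' w0 \<noteq> 0"
  proof (cases "\<exists>a\<in>R - {0}. a * w \<in> M")
    case True
    then obtain a where a: "a \<in> R" "a \<noteq> 0" "a * w \<in> M" by blast
    have in_M: "a * x \<in> M" if x: "x \<in> M'" for x
    proof -
      obtain m r where "x = m + r * w" "m \<in> M" "r \<in> R" using x by (auto simp: M'_def)
      moreover from this have "a * x = a * m + r * (a * w)" by (simp add: algebra_simps)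
      ultimately show ?thesis using add(1) scale(1) a by simp
    qed
    have "functional_on R M' (\<lambda>x. \<psi> (a * x))"
      unfolding functional_on_def
    proof (intro conjI ballI)
      show "(\<lambda>x. \<psi> (a * x)) ` M' \<subseteq> R" using in_M val by auto
      show "\<psi> (a * (x + y)) = \<psi> (a * x) + \<psi> (a * y)" if "x \<in> M'" "y \<in> M'" for x y
        using that in_M add(2) by (simp add: distrib_left)
      show "\<psi> (a * (r * x)) = r * \<psi> (a * x)" if "r \<in> R" "x \<in> M'" for r x
        using scale(2)[OF that(1) in_M[OF that(2)]] by (simp add: mult.left_commute)
    qed
    moreover have "\<psi> (a * w0) \<noteq> 0" using scale(2)[of a w0] a M(2,4) by simp
    ultimately show ?thesis by blast
  next
    case False
    \<comment> \<open>If two representations had different \<open>r\<close>, their difference would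
      put a nonzero multiple of \<open>w\<close> into \<open>M\<close>.\<close>
    have unique: "m = m'" if "m + r * w = m' + r' * w" "m \<in> M" "m' \<in> M" "r \<in> R" "r' \<in> R" for m m' r r'
    proof -
      have "(r - r') * w = m' + (- 1) * m" using that(1) by (simp add: algebra_simps)
      moreover have "m' + (- 1) * m \<in> M"
        using that R by (intro add scale subring_closed)
      ultimately have "(r - r') * w \<in> M" by simp
      moreover have "r - r' \<in> R" using that R by (intro subring_diff)
      ultimately have "r - r' = 0" using False by blast
      then show ?thesis using that(1) by simp
    qed
    define \<psi>' where "\<psi>' z = \<psi> (THE m. m \<in> M \<and> (\<exists>r\<in>R. z = m + r * w))" for z
    have \<psi>': "\<psi>' (m + r * w) = \<psi> m" if "m \<in> M" "r \<in> R" for m r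
    proof -
      have "(THE m'. m' \<in> M \<and> (\<exists>r'\<in>R. m + r * w = m' + r' * w)) = m"
        using that unique by (intro the_equality) auto
      then show ?thesis by (simp add: \<psi>'_def)
    qed
    have "functional_on R M' \<psi>'"
      unfolding functional_on_def
    proof (intro conjI ballI)
      show "\<psi>' ` M' \<subseteq> R" using \<psi>' val by (auto simp: M'_def)
    next
      fix x y assume "x \<in> M'" "y \<in> M'"
      then obtain m r m' r' where *:
        "x = m + r * w" "y = m' + r' * w" "m \<in> M" "m' \<in> M" "r \<in> R" "r' \<in> R"
        by (auto simp: M'_def)
      then have "x + y = (m + m') + (r + r') * w" by (simp add: algebra_simps)
      then have "\<psi>' (x + y) = \<psi> (m + m')"
        using * add(1) R by (simp only: \<psi>' subring_add)
      then show "\<psi>' (x + y) = \<psi>' x + \<psi>' y" using * add(2) by (simp add: \<psi>')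
    next
      fix s x assume s: "s \<in> R" and "x \<in> M'"
      then obtain m r where *: "x = m + r * w" "m \<in> M" "r \<in> R" by (auto simp: M'_def)
      then have "s * x = s * m + (s * r) * w" by (simp add: algebra_simps)
      then have "\<psi>' (s * x) = \<psi> (s * m)"
        using * scale(1) s R by (simp only: \<psi>' subring_mult)
      then show "\<psi>' (s * x) = s * \<psi>' x" using * scale(2) s by (simp add: \<psi>')
    qed
    moreover have "\<psi>' w0 = \<psi> w0" using \<psi>'[of w0 0] M(2) subring_0[OF R] by simp
    ultimately show ?thesis using M(4) by metis
  qed
  ultimately show ?case using sub by blast
qed


section \<open>Complex recurrences\<close>

text \<open>The polynomial \<open>p\<close> in the shift operator, applied to \<open>u\<close>;
  products of polynomials then act as compositions.\<close>

definition rec_op :: "complex poly \<Rightarrow> (nat \<Rightarrow> complex) \<Rightarrow> nat \<Rightarrow> complex" where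
  "rec_op p u n = (\<Sum>i\<le>degree p. coeff p i * u (n + i))"

lemma rec_op_bound:
  assumes "degree p \<le> m"
  shows "rec_op p u n = (\<Sum>i\<le>m. coeff p i * u (n + i))"
  unfolding rec_op_def using assms by (intro sum.mono_neutral_left) (auto simp: coeff_eq_0)

lemma rec_op_0: "rec_op 0 u n = 0"
  by (simp add: rec_op_def)

lemma rec_op_add: "rec_op (p + q) u n = rec_op p u n + rec_op q u n"
proof -
  define m where "m = max (degree p) (degree q)"
  have "degree (p + q) \<le> m" "degree p \<le> m" "degree q \<le> m"
    unfolding m_def by (auto simp: degree_add_le_max)
  then show ?thesis by (simp add: rec_op_bound[of _ m] sum.distrib distrib_right)
qed

lemma rec_op_smult: "rec_op (smult a p) u n = a * rec_op p u n"
  by (simp add: rec_op_bound[of _ "degree p"] degree_smult_le sum_distrib_left mult.assoc)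

lemma rec_op_pCons: "rec_op (pCons a p) u n = a * u n + rec_op p u (Suc n)"
proof -
  have "rec_op (pCons a p) u n = (\<Sum>i\<le>Suc (degree p). coeff (pCons a p) i * u (n + i))"
    by (intro rec_op_bound) (simp add: degree_pCons_le)
  also have "\<dots> = a * u n + rec_op p u (Suc n)"
    by (subst sum.atMost_Suc_shift) (simp add: rec_op_def)
  finally show ?thesis .
qed

lemma rec_op_mult: "rec_op (p * q) u n = rec_op p (rec_op q u) n"
  by (induction p arbitrary: n)
    (simp_all add: rec_op_0 rec_op_pCons rec_op_add rec_op_smult mult_pCons_left)

text \<open>\<open>I\<close> is nonempty because \<open>submodule\<close> admits the empty set,
  which lacks the empty sum.\<close>

lemma functional_sum:
  assumes "submodule R M" "functional_on R M \<psi>" "finite I" "I \<noteq> {}"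
    "\<And>i. i \<in> I \<Longrightarrow> r i \<in> R" "\<And>i. i \<in> I \<Longrightarrow> v i \<in> M"
  shows "\<psi> (\<Sum>i\<in>I. r i * v i) = (\<Sum>i\<in>I. r i * \<psi> (v i)) \<and> (\<Sum>i\<in>I. r i * v i) \<in> M"
  using assms(3-)
proof (induction I rule: finite_ne_induct)
  case (singleton i)
  then show ?case using assms(1,2) by (simp add: submodule_def functional_on_def)
next
  case (insert i I)
  then have "r i * v i \<in> M" "\<psi> (r i * v i) = r i * \<psi> (v i)"
    using assms(1,2) by (auto simp: submodule_def functional_on_def)
  moreover have "\<psi> (\<Sum>i\<in>I. r i * v i) = (\<Sum>i\<in>I. r i * \<psi> (v i))" "(\<Sum>i\<in>I. r i * v i) \<in> M"
    using insert by auto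
  ultimately show ?case
    using insert.hyps assms(1,2) by (simp add: submodule_def functional_on_def)
qed

text \<open>Rescaling makes the recurrence monic over \<open>R\<close>, so a module containing the
  initial values contains all values. If a class had infinitely many zeros and a nonzero term, a
  functional followed by a homomorphism to \<open>\<int>\<close> would keep this term nonzero and
  the zeros zero, against the integer case.\<close>

lemma rec_zeros_specializable:
  assumes R: "specializable R" and h: "h \<in> polys_over R" "coeff h 0 \<noteq> 0"
    and u: "\<And>n. rec_op h u n = 0"
  shows "\<exists>N\<ge>1. \<forall>r. infinite {x. u (r + N * x) = 0} \<longrightarrow> (\<forall>x. u (r + N * x) = 0)"
proof (cases "degree h = 0")
  case True
  then have "u n = 0" for n using u[of n] h(2) by (simp add: rec_op_def)
  then show ?thesis by (intro exI[of _ 1]) auto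
next
  case False
  define m where "m = degree h"
  define L where "L = lead_coeff h"
  have m: "m > 0" using False by (simp add: m_def)
  have sub: "subring R" using R by (simp add: specializable_def)
  have hR: "coeff h i \<in> R" for i using h(1) by (rule polys_over_coeff)
  have L: "L \<in> R" "L \<noteq> 0" using hR h(2) by (auto simp: L_def)
  \<comment> \<open>Multiplied by \<open>L ^ (n + m - 1)\<close>, the recurrence is monic in the
    terms of \<open>v\<close>; the leftover powers of \<open>L\<close> go into
    \<open>g\<close>.\<close>
  define g where "g i = (if i = m then 1 else coeff h i * L ^ (m - 1 - i))" for i
  define v where "v n = L ^ n * u n" for n
  have gR: "g i \<in> R" for i using hR L sub by (auto simp: g_def intro!: subring_closed)
  have v: "solves_rec g m v"
    unfolding solves_rec_def
  proof
    fix n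
    have "L * (g i * v (n + i)) = L ^ (n + m) * (coeff h i * u (n + i))" if "i \<le> m" for i
    proof (cases "i = m")
      case True
      then show ?thesis by (simp add: g_def v_def L_def m_def)
    next
      case False
      then have "n + m = Suc ((m - 1 - i) + (n + i))" using that by simp
      then have "L ^ (n + m) = L * (L ^ (m - 1 - i) * L ^ (n + i))"
        by (simp only: power_Suc power_add)
      then show ?thesis using False by (simp add: g_def v_def mult_ac)
    qed
    then have "L * (\<Sum>i\<le>m. g i * v (n + i)) = L ^ (n + m) * rec_op h u n"
      by (simp add: sum_distrib_left rec_op_def m_def)
    then show "(\<Sum>i\<le>m. g i * v (n + i)) = 0" using u L by simp
  qed
  \<comment> \<open>A prime not dividing the image of this product leaves both outer coefficients,
    \<open>coeff h 0 * L ^ (m - 1)\<close> and \<open>1\<close>, units modulo \<open>p\<close>. It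
    is fixed before the class and the term are, hence so is \<open>N\<close>.\<close>
  have "coeff h 0 * L \<in> R - {0}" using hR L h(2) sub by (auto intro: subring_mult)
  then obtain p where p: "prime p"
      "\<And>r. r \<in> R - {0} \<Longrightarrow> \<exists>\<phi>. hom_on R \<phi> \<and> \<not> int p dvd \<phi> (coeff h 0 * L) \<and> \<phi> r \<noteq> 0"
    using R unfolding specializable_def by blast
  define N :: nat where "N = fact ((p\<^sup>2) ^ m)"
  have "u (r + N * x1) = 0" if inf: "infinite {x. u (r + N * x) = 0}" for r x1
  proof (rule ccontr)
    assume "u (r + N * x1) \<noteq> 0"
    then have "v (r + N * x1) \<noteq> 0" using L by (simp add: v_def)
    then obtain M \<psi> where M: "submodule R M" "insert (v (r + N * x1)) (v ` {..<m}) \<subseteq> M"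
        "functional_on R M \<psi>" "\<psi> (v (r + N * x1)) \<noteq> 0"
      using ex_functional[OF sub _ \<open>v (r + N * x1) \<noteq> 0\<close>, of "v ` {..<m}"] by blast
    have vM: "v n \<in> M" for n
    proof (induction n rule: less_induct)
      case (less n)
      show ?case
      proof (cases "n < m")
        case True
        then show ?thesis using M(2) by auto
      next
        case False
        define k where "k = n - m"
        have n: "n = k + m" using False by (simp add: k_def)
        have "(\<Sum>i<m. g i * v (k + i)) + v n = 0"
          using v unfolding solves_rec_def lessThan_Suc_atMost[symmetric]
          by (auto simp: g_def n dest: spec[of _ k])
        then have "v n = (- 1) * (\<Sum>i<m. g i * v (k + i))" by (simp add: add_eq_0_iff2)
        moreover have "(\<Sum>i<m. g i * v (k + i)) \<in> M"
          using functional_sum[OF M(1,3), of "{..<m}" g "\<lambda>i. v (k + i)"] gR less n m by auto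
        moreover have "- 1 \<in> R" using sub by (intro subring_closed)
        ultimately show ?thesis using M(1) unfolding submodule_def by metis
      qed
    qed
    have y: "(\<Sum>i\<le>m. g i * \<psi> (v (n + i))) = 0" for n
    proof -
      have "(\<Sum>i\<le>m. g i * \<psi> (v (n + i))) = \<psi> (\<Sum>i\<le>m. g i * v (n + i))"
        using functional_sum[OF M(1,3), of "{..m}" g "\<lambda>i. v (n + i)"] gR vM by auto
      also have "\<dots> = \<psi> (0 * v n)" using v by (simp add: solves_rec_def)
      also have "\<dots> = 0 * \<psi> (v n)"
        using M(3) vM subring_0[OF sub] unfolding functional_on_def by blast
      finally show ?thesis by simp
    qed
    have \<psi>R: "\<psi> (v n) \<in> R" for n using M(3) vM by (auto simp: functional_on_def)
    then obtain \<phi> where \<phi>: "hom_on R \<phi>" "\<not> int p dvd \<phi> (coeff h 0 * L)"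
        "\<phi> (\<psi> (v (r + N * x1))) \<noteq> 0"
      using p(2)[of "\<psi> (v (r + N * x1))"] M(4) by blast
    define z where "z n = \<phi> (\<psi> (v n))" for n
    have zrec: "solves_rec (\<lambda>i. \<phi> (g i)) m z"
      unfolding solves_rec_def
    proof
      fix n
      have "(\<Sum>i\<le>m. \<phi> (g i) * z (n + i)) = \<phi> (\<Sum>i\<le>m. g i * \<psi> (v (n + i)))"
        using sub \<phi>(1) gR \<psi>R by (simp add: z_def hom_sum hom_mult subring_mult)
      then show "(\<Sum>i\<le>m. \<phi> (g i) * z (n + i)) = 0" using y sub \<phi>(1) by (simp add: hom_0)
    qed
    have nd: "\<not> int p dvd \<phi> (coeff h 0)" "\<not> int p dvd \<phi> L"
      using \<phi>(2) hom_mult[OF \<phi>(1) hR L(1)] by auto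
    have "\<phi> (g 0) = \<phi> (coeff h 0) * \<phi> L ^ (m - 1)"
      using m sub \<phi>(1) hR L by (simp add: g_def hom_mult hom_power subring_power)
    then have "\<not> int p dvd \<phi> (g 0)"
      using nd p(1) prime_dvd_power[of "int p" "\<phi> L"] by (auto simp: prime_dvd_mult_iff)
    moreover have "\<not> int p dvd \<phi> (g m)"
      using p(1) hom_1[OF \<phi>(1)] by (auto simp: g_def)
    moreover have "{x. u (r + N * x) = 0} \<subseteq> {x. z (r + N * x) = 0}"
    proof safe
      fix x assume "u (r + N * x) = 0"
      then have "v (r + N * x) = 0 * v 0" by (simp add: v_def)
      moreover have "\<psi> (0 * v 0) = 0 * \<psi> (v 0)"
        using M(3) vM subring_0[OF sub] unfolding functional_on_def by blast
      ultimately show "z (r + N * x) = 0" using sub \<phi>(1) by (simp add: z_def hom_0)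
    qed
    then have "infinite {x. z (r + N * x) = 0}" using inf finite_subset by blast
    ultimately have "z (r + N * x1) = 0"
      using integer_rec_zeros[OF zrec p(1)] unfolding N_def by blast
    then show False using \<phi>(3) by (simp add: z_def)
  qed
  then show ?thesis by (intro exI[of _ N]) (auto simp: N_def)
qed

section \<open>Eventual periodicity and unary automata\<close>

definition eventually_periodic :: "(nat \<Rightarrow> bool) \<Rightarrow> bool" where
  "eventually_periodic P \<longleftrightarrow> (\<exists>N\<ge>1. \<exists>M. \<forall>n\<ge>M. P (n + N) = P n)"

text \<open>Any nonzero multiple of \<open>c\<close> still annihilates \<open>u\<close>, so
  \<open>c\<close> is replaced by one with coefficients in a specializable ring. Up to a shift, each
  class modulo \<open>N\<close> then contains finitely many zeros or only zeros, and periodicity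
  begins past the finite ones.\<close>

lemma skolem_mahler_lech:
  assumes c: "c \<noteq> 0" and u: "\<And>n. rec_op c u n = 0"
  shows "eventually_periodic (\<lambda>n. u n = 0)"
proof -
  obtain root where root: "c = smult (lead_coeff c) (\<Prod>i<degree c. [:- root i, 1:])"
    using complex_poly_decompose'[of c] by metis
  obtain R where R: "specializable R" "\<And>x. x \<in> root ` {..<degree c} \<Longrightarrow> algebraic_over R x"
    using ex_specializable_algebraic[of "root ` {..<degree c}"] by auto
  have sub: "subring R" using R by (simp add: specializable_def)
  have "\<forall>i\<in>{..<degree c}. \<exists>P. P \<in> polys_over R \<and> P \<noteq> 0 \<and> poly P (root i) = 0"
    using R(2) unfolding algebraic_over_def by blast
  then obtain P where P: "\<And>i. i < degree c \<Longrightarrow> P i \<in> polys_over R \<and> P i \<noteq> 0 \<and> poly (P i) (root i) = 0"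
    by (metis lessThan_iff)
  define h where "h = (\<Prod>i<degree c. P i)"
  have h: "h \<in> polys_over R" "h \<noteq> 0"
    unfolding h_def using P sub by (auto intro!: polys_over_prod)
  have "(\<Prod>i<degree c. [:- root i, 1:]) dvd h"
    unfolding h_def using P by (intro prod_dvd_prod) (auto simp: poly_eq_0_iff_dvd)
  then have "smult (lead_coeff c) (\<Prod>i<degree c. [:- root i, 1:]) dvd h"
    using c by (intro smult_dvd) auto
  then have "c dvd h" using root by simp
  then obtain d where "h = d * c" by (metis dvdE mult.commute)
  then have hu: "rec_op h u n = 0" for n using u by (simp add: rec_op_mult) (simp add: rec_op_def)
  \<comment> \<open>Removing the factor \<open>X ^ k\<close> makes the constant coefficient nonzero
    at the price of shifting the sequence by \<open>k\<close>.\<close>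
  obtain k h' where h': "h = monom 1 k * h'" "coeff h' 0 \<noteq> 0"
  proof -
    have "\<exists>k h'. h = monom 1 k * h' \<and> coeff h' 0 \<noteq> 0"
      using h(2)
    proof (induction h)
      case (pCons a q)
      show ?case
      proof (cases "a = 0")
        case True
        then obtain k h' where "q = monom 1 k * h'" "coeff h' 0 \<noteq> 0" using pCons by auto
        then show ?thesis using True
          by (intro exI[of _ "Suc k"] exI[of _ h']) (simp add: monom_Suc)
      next
        case False
        then show ?thesis by (intro exI[of _ 0] exI[of _ "pCons a q"]) (simp add: monom_0)
      qed
    qed simp
    then show ?thesis using that by blast
  qed
  have "coeff h' i = coeff h (i + k)" for i unfolding h'(1) by (simp add: coeff_monom_mult)
  then have h'R: "h' \<in> polys_over R" using h(1) by (simp add: polys_over_def)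
  have shift: "rec_op (monom 1 k) w n = w (n + k)" for w n
    by (induction k arbitrary: n) (simp_all add: monom_0 monom_Suc rec_op_pCons rec_op_0)
  have "rec_op h' (\<lambda>n. u (n + k)) n = rec_op h' u (n + k)" for n
    by (simp add: rec_op_def add_ac)
  also have "rec_op h' u (n + k) = rec_op h u n" for n
    unfolding h'(1) rec_op_mult shift ..
  finally have "rec_op h' (\<lambda>n. u (n + k)) n = 0" for n using hu by simp
  then obtain N where N: "N \<ge> 1"
      "\<And>r x. infinite {x. u (r + N * x + k) = 0} \<Longrightarrow> u (r + N * x + k) = 0"
    using rec_zeros_specializable[OF R(1) h'R h'(2), of "\<lambda>n. u (n + k)"] by blast
  define F where "F r = {x. u (r + N * x + k) = 0}" for r
  define G where "G = (\<Union>r\<in>{r. r < N \<and> finite (F r)}. F r)"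
  have "finite G" unfolding G_def by auto
  then obtain b where b: "\<And>x. x \<in> G \<Longrightarrow> x < b" using finite_nat_set_iff_bounded by auto
  \<comment> \<open>The last summand covers the remainder \<open>r < N\<close>, so that the quotient
    \<open>x\<close> is at least \<open>b\<close>.\<close>
  have "(u (n + N) = 0) = (u n = 0)" if n: "n \<ge> k + N * b + N" for n
  proof -
    define r x where "r = (n - k) mod N" and "x = (n - k) div N"
    have nx: "n = r + N * x + k" "n + N = r + N * Suc x + k" using n by (auto simp: r_def x_def)
    have r: "r < N" using N(1) by (simp add: r_def)
    have "N * b \<le> N * x" using nx(1) n r by linarith
    then have "b \<le> x" using N(1) by simp
    show ?thesis
    proof (cases "finite (F r)")
      case True
      then have "x \<notin> F r" "Suc x \<notin> F r"
        using b[of x] b[of "Suc x"] \<open>b \<le> x\<close> r by (auto simp: G_def)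
      then show ?thesis by (simp only: F_def mem_Collect_eq nx[symmetric])
    next
      case False
      then have "u (r + N * y + k) = 0" for y using N(2)[of r y] by (simp add: F_def)
      from this[of x] this[of "Suc x"] show ?thesis by (simp only: nx[symmetric])
    qed
  qed
  then show ?thesis unfolding eventually_periodic_def using N(1) by blast
qed

section \<open>Closure properties of eventual periodicity\<close>

lemma eventually_periodic_multiple:
  fixes P :: "nat \<Rightarrow> bool"
  assumes "\<And>n. n \<ge> M \<Longrightarrow> P (n + N) = P n" "n \<ge> M"
  shows "P (n + N * k) = P n"
proof (induction k)
  case (Suc k)
  then show ?case using assms(1)[of "n + N * k"] assms(2) by (simp add: algebra_simps)
qed simp

lemma eventually_periodic_conj:
  assumes "eventually_periodic P" "eventually_periodic Q"
  shows "eventually_periodic (\<lambda>n. P n \<and> Q n)"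
proof -
  obtain N M where N: "N \<ge> 1" "\<And>n. n \<ge> M \<Longrightarrow> P (n + N) = P n"
    using assms(1) unfolding eventually_periodic_def by blast
  obtain N' M' where N': "N' \<ge> 1" "\<And>n. n \<ge> M' \<Longrightarrow> Q (n + N') = Q n"
    using assms(2) unfolding eventually_periodic_def by blast
  have "P (n + N * N') = P n" "Q (n + N * N') = Q n" if "n \<ge> max M M'" for n
    using eventually_periodic_multiple[of M P N n N'] N
      eventually_periodic_multiple[of M' Q N' n N] N' that by (simp_all add: mult.commute)
  then have "\<forall>n\<ge>max M M'. (P (n + N * N') \<and> Q (n + N * N')) = (P n \<and> Q n)" by blast
  moreover have "N * N' \<ge> 1" using N(1) N'(1) by simp
  ultimately show ?thesis unfolding eventually_periodic_def by blast
qed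

lemma eventually_periodic_not:
  "eventually_periodic P \<Longrightarrow> eventually_periodic (\<lambda>n. \<not> P n)"
  by (simp add: eventually_periodic_def)

lemma eventually_periodic_ball:
  "finite I \<Longrightarrow> (\<And>i. i \<in> I \<Longrightarrow> eventually_periodic (P i)) \<Longrightarrow> eventually_periodic (\<lambda>n. \<forall>i\<in>I. P i n)"
proof (induction I rule: finite_induct)
  case empty
  then show ?case by (auto simp: eventually_periodic_def)
next
  case (insert i I)
  then show ?case using eventually_periodic_conj[of "P i"] by simp
qed

text \<open>A tail of \<open>M\<close> states leads into a cycle of \<open>N\<close> states; the
  last state returns to \<open>M\<close>.\<close>

lemma ex_unary_dfa:
  assumes "eventually_periodic P"
  shows "\<exists>D :: (nat, 'a) dfa. is_dfa {a} D \<and> (\<forall>w\<in>lists {a}. dfa_accepts D w = P (length w))"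
proof -
  obtain N M where N: "N \<ge> 1" "\<And>n. n \<ge> M \<Longrightarrow> P (n + N) = P n"
    using assms unfolding eventually_periodic_def by blast
  define step :: "nat \<Rightarrow> 'a \<Rightarrow> nat" where "step q x = (if Suc q < M + N then Suc q else M)" for q x
  define D where "D = \<lparr>dfa_states = {..<M + N}, dfa_next = step, dfa_init = 0,
    dfa_accepting = {q. q < M + N \<and> P q}\<rparr>"
  have step: "step q x = (if Suc q < M + N then Suc q else M)" for q x
    by (simp add: step_def)
  have "is_dfa {a} D" using N(1) by (auto simp: is_dfa_def D_def step)
  \<comment> \<open>The state is the length itself, or the length reduced by a multiple of
    \<open>N\<close> to a number at least \<open>M\<close>, which does not change
    \<open>P\<close>.\<close>
  have run: "foldl step 0 w < M + N \<and>
      (foldl step 0 w = length w \<or> M \<le> foldl step 0 w \<and> (\<exists>k. length w = foldl step 0 w + N * k))" for w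
  proof (induction w rule: rev_induct)
    case Nil
    then show ?case using N(1) by simp
  next
    case (snoc x w)
    define q where "q = foldl step 0 w"
    have q: "q < M + N" "q = length w \<or> M \<le> q \<and> (\<exists>k. length w = q + N * k)"
      using snoc by (auto simp: q_def)
    have run_snoc: "foldl step 0 (w @ [x]) = (if Suc q < M + N then Suc q else M)"
      by (simp add: q_def step)
    show ?case
    proof (cases "Suc q < M + N")
      case True
      then show ?thesis unfolding run_snoc using q by auto
    next
      case False
      then have "Suc q = M + N" using q by simp
      moreover obtain k where "length w = q + N * k" using q(2) by (metis add_0_right mult_0_right)
      ultimately have "Suc (length w) = M + N * Suc k" by simp
      then have "\<exists>k. Suc (length w) = M + N * k" by blast
      then show ?thesis unfolding run_snoc using False N(1) by simp
    qed
  qed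
  have "dfa_accepts D w = P (length w)" for w
  proof -
    have "P (length w) = P (foldl step 0 w)"
    proof (cases "foldl step 0 w = length w")
      case False
      then obtain k where "M \<le> foldl step 0 w" "length w = foldl step 0 w + N * k" using run by blast
      then show ?thesis using eventually_periodic_multiple[of M P N "foldl step 0 w" k] N(2) by simp
    qed simp
    then show ?thesis using run[of w] by (simp add: dfa_accepts_def D_def)
  qed
  with \<open>is_dfa {a} D\<close> show ?thesis by blast
qed

section \<open>Linear recurrences from powers of a matrix\<close>

text \<open>The first \<open>CARD('q) + 1\<close> iterates satisfy a nontrivial linear relation, and
  applying \<open>U\<close> propagates it to every later window. One polynomial serves all
  coordinates.\<close>

lemma power_annihilator:
  fixes U :: "complex ^ 'q::finite ^ 'q"
  shows "\<exists>c. c \<noteq> 0 \<and> (\<forall>n q. rec_op c (\<lambda>n. (((*v) U) ^^ n) v $ q) n = 0)"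
proof -
  define w where "w n = (((*v) U) ^^ n) v" for n
  define m where "m = CARD('q)"
  have "\<exists>f. (\<exists>i\<le>m. f i \<noteq> 0) \<and> (\<Sum>i\<le>m. f i *s w i) = 0"
  \<comment> \<open>Linear dependence of a set does not see repetitions, so coinciding iterates need
    a relation of their own.\<close>
  proof (cases "inj_on w {..m}")
    case True
    then have "card (w ` {..m}) = Suc m" by (simp add: card_image)
    then have "vec.dependent (w ` {..m})"
      using dim_subset_UNIV_cart_gen[of "w ` {..m}"] by (intro vec.dependent_biggerset_general) (simp add: m_def)
    then obtain g where g: "\<exists>x\<in>w ` {..m}. g x \<noteq> 0" "(\<Sum>x\<in>w ` {..m}. g x *s x) = 0"
      using vec.dependent_finite[of "w ` {..m}"] by auto
    have "(\<Sum>i\<le>m. g (w i) *s w i) = 0" using g(2) True by (simp add: sum.reindex)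
    then show ?thesis using g(1) by (intro exI[of _ "\<lambda>i. g (w i)"]) auto
  next
    case False
    then obtain i j where ij: "i \<le> m" "j \<le> m" "i \<noteq> j" "w i = w j" by (auto simp: inj_on_def)
    define f :: "nat \<Rightarrow> complex" where "f k = (if k = i then 1 else if k = j then - 1 else 0)" for k
    have "(\<Sum>k\<le>m. f k *s w k) = (\<Sum>k\<in>{i, j}. f k *s w k)"
      using ij by (intro sum.mono_neutral_right) (auto simp: f_def)
    also have "\<dots> = 0" using ij by (simp add: f_def vec_eq_iff)
    finally show ?thesis using ij by (intro exI[of _ f]) (auto simp: f_def)
  qed
  then obtain f i where f: "i \<le> m" "f i \<noteq> 0" "(\<Sum>i\<le>m. f i *s w i) = 0" by blast
  define c where "c = (\<Sum>i\<le>m. monom (f i) i)"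
  have coeff: "coeff c i = (if i \<le> m then f i else 0)" for i
    by (simp add: c_def coeff_sum)
  have "degree c \<le> m" by (intro degree_le) (simp add: coeff)
  have wn: "(\<Sum>i\<le>m. f i *s w (n + i)) = 0" for n
  proof (induction n)
    case 0
    then show ?case using f(3) by simp
  next
    case (Suc n)
    have "(\<Sum>i\<le>m. f i *s w (Suc n + i)) = U *v (\<Sum>i\<le>m. f i *s w (n + i))"
      by (simp add: vec.sum vec.scale w_def)
    then show ?case using Suc by simp
  qed
  have "rec_op c (\<lambda>n. w n $ q) n = 0" for n q
  proof -
    have "rec_op c (\<lambda>n. w n $ q) n = (\<Sum>i\<le>m. f i *s w (n + i)) $ q"
      unfolding rec_op_bound[OF \<open>degree c \<le> m\<close>] by (simp add: coeff)
    then show ?thesis using wn by simp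
  qed
  moreover have "c \<noteq> 0" using f(1,2) coeff[of i] by auto
  ultimately show ?thesis unfolding w_def by blast
qed

theorem theorem1:
  fixes a :: 'a
    and Pyes Pno :: "'a list set"
    and A :: "('q::finite, 'a) qfa"
  assumes "promise_problem {a} Pyes Pno"
    and "is_qfa {a} A"
    and "qfa_solves_exactly A Pyes Pno"
  shows "\<exists>D :: (nat, 'a) dfa. is_dfa {a} D \<and> dfa_solves D Pyes Pno"
proof -
  define w where "w n = (((*v) (qfa_matrix A a)) ^^ n) (qfa_init A)" for n
  obtain c where c: "c \<noteq> 0" "\<And>n q. rec_op c (\<lambda>n. w n $ q) n = 0"
    unfolding w_def using power_annihilator by blast
  have "eventually_periodic (\<lambda>n. \<forall>q\<in>qfa_accepting A. w n $ q = 0)"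
    by (intro eventually_periodic_ball skolem_mahler_lech[OF c]) simp
  \<comment> \<open>The DFA is to accept when the acceptance probability is nonzero, that is, when
    some accepting amplitude is; on promised words this separates 1 from 0.\<close>
  then have "eventually_periodic (\<lambda>n. \<not> (\<forall>q\<in>qfa_accepting A. w n $ q = 0))"
    by (rule eventually_periodic_not)
  from ex_unary_dfa[OF this, of a] obtain D :: "(nat, 'a) dfa" where D: "is_dfa {a} D"
      "\<And>x. x \<in> lists {a} \<Longrightarrow> dfa_accepts D x = (\<not> (\<forall>q\<in>qfa_accepting A. w (length x) $ q = 0))"
    by blast
  have "dfa_accepts D x \<longleftrightarrow> qfa_accept_prob A x \<noteq> 0" if x: "x \<in> lists {a}" for x
  proof -
    have "x = replicate (length x) a" using x by (induction x) auto
    then have "qfa_final A x = w (length x)"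
      unfolding qfa_final_def w_def by (metis fold_replicate)
    then have "qfa_accept_prob A x = 0 \<longleftrightarrow> (\<forall>q\<in>qfa_accepting A. w (length x) $ q = 0)"
      unfolding qfa_accept_prob_def by (simp add: sum_nonneg_eq_0_iff)
    then show ?thesis using D(2)[OF x] by simp
  qed
  moreover have "Pyes \<subseteq> lists {a}" "Pno \<subseteq> lists {a}"
    using assms(1) by (auto simp: promise_problem_def)
  ultimately have "dfa_solves D Pyes Pno"
    using assms(3) unfolding dfa_solves_def qfa_solves_exactly_def by (metis subsetD zero_neq_one)
  then show ?thesis using D(1) by blast
qed

end
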